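(* If $f_1=f_1(x^2)$ depends only on $x^2$ and $f_2=f_2(x^1)$ depends only on $x^1$, then the following assertions are equivalent: (1) $(I,\tilde g)$ is a flat Riemannian manifold; (2) $f_1$ and $f_2$ satisfy $$\frac{f_1''f_1-2(f_1')^2}{f_1^4}=-\frac{f_2''f_2-2(f_2')^2}{f_2^4}=\text{constant}$$ on $I$ (i.e. the two expressions are equal to one and the same real constant).
   Context: Let $I=I_1\times I_2\times I_3\subseteq\mathbb R^3$ with $I_1,I_2,I_3\subseteq\mathbb R$ open intervals and standard coordinates $x^1,x^2,x^3$. Let $f_1,f_2$ be smooth nowhere zero functions on $I$ and endow $I$ with the Riemannian metric $\tilde g=\frac{1}{f_1^2}dx^1\otimes dx^1+\frac{1}{f_2^2}dx^2\otimes dx^2+dx^3\otimes dx^3$. Flat means that the Riemann curvature tensor of $\tilde g$ vanishes identically. A prime denotes the derivative of a function of a single variable with respect to that variable. *)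

theory Defs
  imports "HOL-Analysis.Analysis"
begin

definition partial :: "'n::finite \<Rightarrow> (real^'n \<Rightarrow> real) \<Rightarrow> real^'n \<Rightarrow> real" where
  "partial i f x = frechet_derivative f (at x) (axis i 1)"

(* Intended for open U only: differentiability is taken in a full neighbourhood. *)
primrec Ck_on :: "nat \<Rightarrow> (real^'n::finite) set \<Rightarrow> (real^'n \<Rightarrow> real) \<Rightarrow> bool" where
  "Ck_on 0 U f \<longleftrightarrow> continuous_on U f"
| "Ck_on (Suc k) U f \<longleftrightarrow> (\<forall>x\<in>U. f differentiable (at x)) \<and> (\<forall>i. Ck_on k U (partial i f))"

definition smooth_on :: "(real^'n::finite) set \<Rightarrow> (real^'n \<Rightarrow> real) \<Rightarrow> bool" where
  "smooth_on U f \<longleftrightarrow> (\<forall>k. Ck_on k U f)"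

(* A (0,2)-tensor field on a subset of R^n; the tangent space at every point is R^n. *)
type_synonym 'n tensor2 = "real^'n \<Rightarrow> real^'n \<Rightarrow> real^'n \<Rightarrow> real"

definition component :: "'n::finite tensor2 \<Rightarrow> 'n \<Rightarrow> 'n \<Rightarrow> real^'n \<Rightarrow> real" where
  "component g i j x = g x (axis i 1) (axis j 1)"

definition riemannian_metric_on :: "(real^'n::finite) set \<Rightarrow> 'n tensor2 \<Rightarrow> bool" where
  "riemannian_metric_on U g \<longleftrightarrow>
     open U \<and>
     (\<forall>x\<in>U. bilinear (g x)) \<and>
     (\<forall>x\<in>U. \<forall>u v. g x u v = g x v u) \<and>
     (\<forall>x\<in>U. \<forall>u. u \<noteq> 0 \<longrightarrow> g x u u > 0) \<and>
     (\<forall>i j. smooth_on U (component g i j))"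

definition inverse_component :: "'n::finite tensor2 \<Rightarrow> 'n \<Rightarrow> 'n \<Rightarrow> real^'n \<Rightarrow> real" where
  "inverse_component g k l x = matrix_inv (\<chi> i j. component g i j x) $ k $ l"

(* Gamma^k_{ij} of the Levi-Civita connection in the standard coordinates. *)
definition christoffel :: "'n::finite tensor2 \<Rightarrow> 'n \<Rightarrow> 'n \<Rightarrow> 'n \<Rightarrow> real^'n \<Rightarrow> real" where
  "christoffel g k i j x =
     (1/2) * (\<Sum>l\<in>UNIV. inverse_component g k l x *
       (partial i (component g j l) x + partial j (component g i l) x
         - partial l (component g i j) x))"

(* The components R^l_{kij}, i.e. R(e_i, e_j) e_k = (SUM l. R^l_{kij} e_l), where
   R(X,Y)Z = nabla_X nabla_Y Z - nabla_Y nabla_X Z - nabla_[X,Y] Z. *)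
definition riemann_tensor :: "'n::finite tensor2 \<Rightarrow> 'n \<Rightarrow> 'n \<Rightarrow> 'n \<Rightarrow> 'n \<Rightarrow> real^'n \<Rightarrow> real" where
  "riemann_tensor g l k i j x =
     partial i (christoffel g l j k) x - partial j (christoffel g l i k) x
     + (\<Sum>m\<in>UNIV. christoffel g l i m x * christoffel g m j k x
                  - christoffel g l j m x * christoffel g m i k x)"

definition flat_riemannian_on :: "(real^'n::finite) set \<Rightarrow> 'n tensor2 \<Rightarrow> bool" where
  "flat_riemannian_on U g \<longleftrightarrow>
     riemannian_metric_on U g \<and> (\<forall>x\<in>U. \<forall>l k i j. riemann_tensor g l k i j x = 0)"

definition box3 :: "real set \<Rightarrow> real set \<Rightarrow> real set \<Rightarrow> (real^3) set" where
  "box3 I1 I2 I3 = {x. x $ 1 \<in> I1 \<and> x $ 2 \<in> I2 \<and> x $ 3 \<in> I3}"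

definition dx_dx :: "'n::finite \<Rightarrow> real^'n \<Rightarrow> real^'n \<Rightarrow> real" where
  "dx_dx i u v = u $ i * v $ i"

definition g_tilde :: "(real^3 \<Rightarrow> real) \<Rightarrow> (real^3 \<Rightarrow> real) \<Rightarrow> 3 tensor2" where
  "g_tilde f1 f2 x u v =
     1 / (f1 x)^2 * dx_dx 1 u v + 1 / (f2 x)^2 * dx_dx 2 u v + dx_dx 3 u v"

end

(*
  With f1 = h1(x2) and f2 = h2(x1), every Christoffel symbol is a product of a function of x1
  and a function of x2, and the only nonzero curvature components are, up to sign,
  h1^2 (E1 + E2) and h2^2 (E1 + E2), where E_i = (h_i'' h_i - 2 h_i'^2) / h_i^4.
  Flatness is therefore E1(x2) = - E2(x1) on a product domain, which forces both sides to be constant.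
*)
theory Submission
  imports Defs
begin

section \<open>Calculus rules for partial derivatives\<close>

lemma partial_eqI:
  assumes "(f has_derivative D) (at x)"
  shows "partial i f x = D (axis i 1)"
  using assms frechet_derivative_at partial_def by metis

lemma has_derivative_cong_open:
  assumes "open U" "x \<in> U" "\<And>z. z \<in> U \<Longrightarrow> f z = g z"
  shows "(f has_derivative D) (at x) \<longleftrightarrow> (g has_derivative D) (at x)"
  using assms has_derivative_transform_within_open by metis

lemma differentiable_cong_open:
  assumes "open U" "x \<in> U" "\<And>z. z \<in> U \<Longrightarrow> f z = g z"
  shows "f differentiable at x \<longleftrightarrow> g differentiable at x"
  unfolding differentiable_def using has_derivative_cong_open[OF assms] by simp

text \<open>\<open>frechet_derivative\<close> is a choice from the set of derivatives at
  \<open>x\<close>, and this set depends only on the germ of the function. The equality therefore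
  also covers points of non-differentiability.\<close>

lemma partial_cong_open:
  assumes "open U" "x \<in> U" "\<And>z. z \<in> U \<Longrightarrow> f z = g z"
  shows "partial i f x = partial i g x"
  unfolding partial_def frechet_derivative_def
  using has_derivative_cong_open[OF assms] by simp

lemma partial_const [simp]: "partial i (\<lambda>x. c) = (\<lambda>x. 0)"
  by (auto simp: fun_eq_iff intro!: partial_eqI[where D = "\<lambda>h. 0"])

lemma partial_add:
  assumes "f differentiable at x" "g differentiable at x"
  shows "partial i (\<lambda>x. f x + g x) x = partial i f x + partial i g x"
proof -
  have "((\<lambda>x. f x + g x) has_derivative
      (\<lambda>h. frechet_derivative f (at x) h + frechet_derivative g (at x) h)) (at x)"
    using assms by (intro has_derivative_add) (simp_all flip: frechet_derivative_works)
  from partial_eqI[OF this] show ?thesis by (simp add: partial_def)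
qed

lemma partial_mult:
  fixes f g :: "real^'n::finite \<Rightarrow> real"
  assumes "f differentiable at x" "g differentiable at x"
  shows "partial i (\<lambda>x. f x * g x) x = f x * partial i g x + partial i f x * g x"
proof -
  have "((\<lambda>x. f x * g x) has_derivative
      (\<lambda>h. f x * frechet_derivative g (at x) h + frechet_derivative f (at x) h * g x)) (at x)"
    using assms by (intro has_derivative_mult) (simp_all flip: frechet_derivative_works)
  from partial_eqI[OF this] show ?thesis by (simp add: partial_def)
qed

text \<open>The right-hand side is written as an iterated product so that closure of
  \<open>Ck_on\<close> under multiplication applies to it directly.\<close>

lemma partial_inverse:
  fixes f :: "real^'n::finite \<Rightarrow> real"
  assumes "f differentiable at x" "f x \<noteq> 0"
  shows "partial i (\<lambda>x. inverse (f x)) x = - 1 * partial i f x * inverse (f x) * inverse (f x)"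
proof -
  have "((\<lambda>x. inverse (f x)) has_derivative
      (\<lambda>h. - (inverse (f x) * frechet_derivative f (at x) h * inverse (f x)))) (at x)"
    using assms by (intro Deriv.has_derivative_inverse) (simp_all flip: frechet_derivative_works)
  from partial_eqI[OF this] show ?thesis by (simp add: partial_def)
qed

section \<open>Closure properties of \<open>Ck_on\<close> and \<open>smooth_on\<close>\<close>

text \<open>The sum, product and inverse rules hold only at points of \<open>U\<close>. This lemma
  lets them replace a partial derivative inside \<open>Ck_on\<close> all the same.\<close>

lemma Ck_on_cong:
  assumes "open U" "\<And>z. z \<in> U \<Longrightarrow> f z = g z"
  shows "Ck_on k U f \<longleftrightarrow> Ck_on k U g"
  using assms(2)
proof (induction k arbitrary: f g)
  case 0
  then show ?case by (auto cong: continuous_on_cong)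
next
  case (Suc k)
  have "Ck_on k U (partial i f) \<longleftrightarrow> Ck_on k U (partial i g)" for i
    by (rule Suc.IH) (rule partial_cong_open[OF assms(1) _ Suc.prems])
  then show ?case
    using differentiable_cong_open[OF assms(1) _ Suc.prems] by auto
qed

lemma Ck_on_SucD: "Ck_on (Suc k) U f \<Longrightarrow> Ck_on k U f"
proof (induction k arbitrary: f)
  case 0
  then show ?case
    by (auto intro!: continuous_at_imp_continuous_on differentiable_imp_continuous_within)
qed auto

lemma Ck_on_const: "Ck_on k U (\<lambda>x. c)"
  by (induction k arbitrary: c) auto

lemma Ck_on_add:
  assumes "open U" "Ck_on k U f" "Ck_on k U g"
  shows "Ck_on k U (\<lambda>x. f x + g x)"
  using assms(2,3)
proof (induction k arbitrary: f g)
  case 0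
  then show ?case by (auto intro: continuous_on_add)
next
  case (Suc k)
  have "Ck_on k U (partial i (\<lambda>x. f x + g x))" for i
    using Suc by (subst Ck_on_cong[OF assms(1) partial_add]) auto
  then show ?case using Suc.prems by auto
qed

lemma Ck_on_mult:
  assumes "open U" "Ck_on k U f" "Ck_on k U g"
  shows "Ck_on k U (\<lambda>x. f x * g x)"
  using assms(2,3)
proof (induction k arbitrary: f g)
  case 0
  then show ?case by (auto intro: continuous_on_mult)
next
  case (Suc k)
  have "Ck_on k U (partial i (\<lambda>x. f x * g x))" for i
  proof (subst Ck_on_cong[OF assms(1) partial_mult])
    show "Ck_on k U (\<lambda>x. f x * partial i g x + partial i f x * g x)"
      using Suc.prems Suc.prems[THEN Ck_on_SucD] by (intro Ck_on_add[OF assms(1)] Suc.IH) auto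
  qed (use Suc.prems in auto)
  then show ?case using Suc.prems by auto
qed

text \<open>The partial derivative of the inverse is a product of \<open>partial i f\<close> and the
  inverse itself. The induction hypothesis gives the inverse one order lower, which is exactly the
  order needed for its derivative.\<close>

lemma Ck_on_inverse:
  assumes "open U" "Ck_on k U f" "\<And>x. x \<in> U \<Longrightarrow> f x \<noteq> 0"
  shows "Ck_on k U (\<lambda>x. inverse (f x))"
  using assms(2)
proof (induction k)
  case 0
  then show ?case using assms(3) by (auto intro: continuous_on_inverse)
next
  case (Suc k)
  have "Ck_on k U (\<lambda>x. inverse (f x))"
    using Suc Ck_on_SucD by blast
  then have "Ck_on k U (\<lambda>x. - 1 * partial i f x * inverse (f x) * inverse (f x))" for i
    using Suc.prems by (intro Ck_on_mult[OF assms(1)] Ck_on_const) auto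
  then have "Ck_on k U (partial i (\<lambda>x. inverse (f x)))" for i
    using Suc.prems assms(3) by (subst Ck_on_cong[OF assms(1) partial_inverse]) auto
  then show ?case using Suc.prems assms(3) by auto
qed

lemma smooth_on_inverse_square:
  assumes "open U" "smooth_on U f" "\<And>x. x \<in> U \<Longrightarrow> f x \<noteq> 0"
  shows "smooth_on U (\<lambda>x. 1 / (f x)^2)"
proof -
  have "Ck_on k U (\<lambda>x. inverse (f x) * inverse (f x))" for k
    using assms Ck_on_mult[OF assms(1)] Ck_on_inverse[OF assms(1)]
    by (auto simp: smooth_on_def)
  then show ?thesis
    unfolding smooth_on_def by (simp add: power2_eq_square field_simps)
qed

lemma smooth_on_differentiable: "smooth_on U f \<Longrightarrow> x \<in> U \<Longrightarrow> f differentiable at x"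
  unfolding smooth_on_def by (metis Ck_on.simps(2))

lemma smooth_on_partial: "smooth_on U f \<Longrightarrow> smooth_on U (partial i f)"
  unfolding smooth_on_def by (metis Ck_on.simps(2))

lemma smooth_on_const: "smooth_on U (\<lambda>x. c)"
  by (simp add: smooth_on_def Ck_on_const)

section \<open>Passing between functions on space and functions of one variable\<close>

text \<open>Restricting \<open>f\<close> to the line through \<open>x\<close> in direction
  \<open>j\<close> recovers \<open>h\<close> near \<open>x $ j\<close>, so the chain rule turns the
  partial derivative into an ordinary one.\<close>

lemma single_coordinate_has_derivative:
  fixes f :: "real^'n::finite \<Rightarrow> real"
  assumes "open U" "x \<in> U" "f differentiable at x" "\<And>z. z \<in> U \<Longrightarrow> f z = h (z $ j)"
  shows "(h has_real_derivative partial j f x) (at (x $ j))"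
proof -
  let ?c = "\<lambda>t. x + (t - x $ j) *\<^sub>R axis j 1"
  have c: "(?c has_derivative (\<lambda>t. t *\<^sub>R axis j 1)) (at (x $ j))"
    by (auto intro!: derivative_eq_intros)
  have "(f has_derivative frechet_derivative f (at x)) (at x)"
    using assms(3) by (simp add: frechet_derivative_works)
  then have "(f has_derivative frechet_derivative f (at x)) (at (?c (x $ j)))" by simp
  from diff_chain_at[OF c this]
  have D: "((f \<circ> ?c) has_derivative (\<lambda>t. frechet_derivative f (at x) (t *\<^sub>R axis j 1))) (at (x $ j))"
    by (simp add: o_def)
  have lin: "linear (frechet_derivative f (at x))"
    using assms(3) by (rule linear_frechet_derivative)
  have "((f \<circ> ?c) has_real_derivative partial j f x) (at (x $ j))"
    unfolding has_field_derivative_def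
    by (rule has_derivative_eq_rhs[OF D]) (auto simp: partial_def linear_scale[OF lin])
  \<comment> \<open>The line stays in \<open>U\<close> for parameters near \<open>x $ j\<close>;
    only there does \<open>f\<close> agree with \<open>h\<close>.\<close>
  moreover have "open (?c -` U)"
    using assms(1) by (intro open_vimage) (auto intro!: continuous_intros)
  moreover have "(f \<circ> ?c) t = h t" if "t \<in> ?c -` U" for t
    using that assms(4)[of "?c t"] by (simp add: axis_def)
  ultimately show ?thesis
    using assms(2) has_field_derivative_transform_within_open[where S = "?c -` U"] by force
qed

text \<open>On \<open>U\<close>, \<open>partial j f\<close> is again smooth and depends on
  coordinate \<open>j\<close> alone, through \<open>deriv h\<close>. The preceding lemma can thus be
  applied a second time.\<close>

lemma single_coordinate_twice_derivative:
  fixes f :: "real^'n::finite \<Rightarrow> real"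
  assumes "open U" "smooth_on U f" "\<And>z. z \<in> U \<Longrightarrow> f z = h (z $ j)" "x \<in> U"
  shows "(h has_real_derivative deriv h (x $ j)) (at (x $ j))"
    and "(deriv h has_real_derivative deriv (deriv h) (x $ j)) (at (x $ j))"
proof -
  have D: "(h has_real_derivative partial j f z) (at (z $ j))" if "z \<in> U" for z
    using single_coordinate_has_derivative assms smooth_on_differentiable that by blast
  then have eq: "partial j f z = deriv h (z $ j)" if "z \<in> U" for z
    using DERIV_imp_deriv[OF D[OF that]] by simp
  show "(h has_real_derivative deriv h (x $ j)) (at (x $ j))"
    using D eq assms(4) by metis
  have "(deriv h has_real_derivative partial j (partial j f) x) (at (x $ j))"
    using assms(1,4) smooth_on_differentiable[OF smooth_on_partial[OF assms(2)] assms(4)] eq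
    by (rule single_coordinate_has_derivative)
  then show "(deriv h has_real_derivative deriv (deriv h) (x $ j)) (at (x $ j))"
    by (simp add: DERIV_imp_deriv)
qed

text \<open>This one rule differentiates both the metric components and the Christoffel symbols. A
  function of a single coordinate is covered by taking the other factor constant 1.\<close>

lemma partial_separated:
  fixes f :: "real^3 \<Rightarrow> real"
  assumes "open U" "x \<in> U" "\<And>z. z \<in> U \<Longrightarrow> f z = a (z $ 1) * b (z $ 2)"
    and a: "(a has_real_derivative a') (at (x $ 1))"
    and b: "(b has_real_derivative b') (at (x $ 2))"
  shows "partial i f x =
    (if i = 1 then a' * b (x $ 2) else if i = 2 then a (x $ 1) * b' else 0)"
proof -
  have proj: "((\<lambda>z::real^3. z $ j) has_derivative (\<lambda>h. h $ j)) (at x)" for j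
    by (rule bounded_linear_imp_has_derivative) (rule bounded_linear_vec_nth)
  have 1: "((\<lambda>z. a (z $ 1)) has_derivative (\<lambda>h. a' * h $ 1)) (at x)"
    using has_derivative_compose[OF proj a[unfolded has_field_derivative_def]] .
  have 2: "((\<lambda>z. b (z $ 2)) has_derivative (\<lambda>h. b' * h $ 2)) (at x)"
    using has_derivative_compose[OF proj b[unfolded has_field_derivative_def]] .
  have "partial i f x = partial i (\<lambda>z. a (z $ 1) * b (z $ 2)) x"
    by (rule partial_cong_open[OF assms(1-3)])
  also have "\<dots> = a (x $ 1) * (b' * axis i 1 $ 2) + a' * axis i 1 $ 1 * b (x $ 2)"
    by (rule partial_eqI[OF has_derivative_mult[OF 1 2]])
  finally show ?thesis by (auto simp: axis_def)
qed

section \<open>The box and the metric: components, inverse matrix, positivity\<close>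

lemma open_box3:
  assumes "open I1" "open I2" "open I3"
  shows "open (box3 I1 I2 I3)"
proof -
  have "box3 I1 I2 I3 = (\<lambda>x. x $ 1) -` I1 \<inter> (\<lambda>x. x $ 2) -` I2 \<inter> (\<lambda>x. x $ 3) -` I3"
    by (auto simp: box3_def)
  then show ?thesis
    using assms by (auto intro!: open_Int open_vimage continuous_intros)
qed

lemma component_g_tilde:
  "component (g_tilde f1 f2) i j =
     (if i = j then if i = 1 then (\<lambda>x. 1 / (f1 x)^2) else if i = 2 then (\<lambda>x. 1 / (f2 x)^2)
      else (\<lambda>x. 1) else (\<lambda>x. 0))"
  using exhaust_3[of i] exhaust_3[of j]
  by (auto simp: component_def g_tilde_def dx_dx_def axis_def fun_eq_iff)

lemma inverse_component_g_tilde: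
  assumes "f1 x \<noteq> 0" "f2 x \<noteq> 0"
  shows "inverse_component (g_tilde f1 f2) k l x =
    (if k = l then if k = 1 then (f1 x)^2 else if k = 2 then (f2 x)^2 else 1 else 0)"
proof -
  let ?A = "(\<chi> i j. component (g_tilde f1 f2) i j x) :: real^3^3"
  let ?B = "(\<chi> k l. if k = l then if k = 1 then (f1 x)^2 else if k = 2 then (f2 x)^2 else 1 else 0) :: real^3^3"
  have AB: "?A ** ?B = mat 1" and BA: "?B ** ?A = mat 1"
    using assms by (simp_all add: matrix_matrix_mult_def mat_def vec_eq_iff forall_3 sum_3
        component_g_tilde)
  \<comment> \<open>\<open>matrix_inv\<close> is defined by choice; \<open>?B\<close> witnesses that
    a two-sided inverse exists. Uniqueness of inverses then identifies the chosen one with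
    \<open>?B\<close>.\<close>
  have "matrix_inv ?A ** ?A = mat 1"
    using someI[of "\<lambda>B. ?A ** B = mat 1 \<and> B ** ?A = mat 1" ?B] AB BA
    unfolding matrix_inv_def by blast
  then have "matrix_inv ?A = ?B"
    using AB matrix_mul_assoc[of "matrix_inv ?A" ?A ?B] by simp
  then show ?thesis by (simp add: inverse_component_def)
qed

lemma riemannian_metric_g_tilde:
  assumes "open U" "smooth_on U f1" "smooth_on U f2"
    and "\<And>x. x \<in> U \<Longrightarrow> f1 x \<noteq> 0" "\<And>x. x \<in> U \<Longrightarrow> f2 x \<noteq> 0"
  shows "riemannian_metric_on U (g_tilde f1 f2)"
  unfolding riemannian_metric_on_def
proof (intro conjI ballI allI impI)
  fix x u assume x: "x \<in> U" and u: "(u::real^3) \<noteq> 0"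
  have p: "1 / (f1 x)^2 > 0" "1 / (f2 x)^2 > 0" using assms x by auto
  \<comment> \<open>The term of a nonzero coordinate is strictly positive, and the other two are
    nonnegative.\<close>
  have "u $ 1 \<noteq> 0 \<or> u $ 2 \<noteq> 0 \<or> u $ 3 \<noteq> 0"
    using u by (auto simp: vec_eq_iff forall_3)
  moreover have "1 / (f1 x)^2 * (u $ 1 * u $ 1) \<ge> 0" "1 / (f2 x)^2 * (u $ 2 * u $ 2) \<ge> 0"
    "u $ 3 * u $ 3 \<ge> 0" by simp_all
  moreover have "u $ 1 \<noteq> 0 \<Longrightarrow> 1 / (f1 x)^2 * (u $ 1 * u $ 1) > 0"
    "u $ 2 \<noteq> 0 \<Longrightarrow> 1 / (f2 x)^2 * (u $ 2 * u $ 2) > 0"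
    "u $ 3 \<noteq> 0 \<Longrightarrow> u $ 3 * u $ 3 > 0"
    using p by (auto simp: zero_less_mult_iff linorder_neq_iff)
  ultimately show "g_tilde f1 f2 x u u > 0"
    unfolding g_tilde_def dx_dx_def by linarith
next
  fix i j :: 3
  show "smooth_on U (component (g_tilde f1 f2) i j)"
    using assms by (auto simp: component_g_tilde intro: smooth_on_inverse_square smooth_on_const)
next
  fix x
  have "bilinear (\<lambda>u v. a * dx_dx 1 u v + b * dx_dx 2 u v + dx_dx 3 u (v :: real^3))" for a b
    by (auto simp: bilinear_def dx_dx_def algebra_simps intro!: linearI)
  then show "bilinear (g_tilde f1 f2 x)"
    unfolding g_tilde_def .
next
  fix x u v
  have "dx_dx i u v = dx_dx i v (u :: real^3)" for i
    by (simp add: dx_dx_def)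
  then show "g_tilde f1 f2 x u v = g_tilde f1 f2 x v u"
    unfolding g_tilde_def by presburger
qed (rule assms(1))

section \<open>Curvature of the separated metric\<close>

text \<open>First and second derivatives enter as parameters with their derivative facts, so the
  curvature computation is pure one-variable calculus and algebra.\<close>

locale separated_metric =
  fixes U :: "(real^3) set" and f1 f2 :: "real^3 \<Rightarrow> real"
    and h1 h1' h1'' h2 h2' h2'' :: "real \<Rightarrow> real"
  assumes open_U: "open U"
    and f1: "x \<in> U \<Longrightarrow> f1 x = h1 (x $ 2)"
    and f2: "x \<in> U \<Longrightarrow> f2 x = h2 (x $ 1)"
    and nz1: "x \<in> U \<Longrightarrow> h1 (x $ 2) \<noteq> 0"
    and nz2: "x \<in> U \<Longrightarrow> h2 (x $ 1) \<noteq> 0"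
    and D1: "x \<in> U \<Longrightarrow> (h1 has_real_derivative h1' (x $ 2)) (at (x $ 2))"
    and DD1: "x \<in> U \<Longrightarrow> (h1' has_real_derivative h1'' (x $ 2)) (at (x $ 2))"
    and D2: "x \<in> U \<Longrightarrow> (h2 has_real_derivative h2' (x $ 1)) (at (x $ 1))"
    and DD2: "x \<in> U \<Longrightarrow> (h2' has_real_derivative h2'' (x $ 1)) (at (x $ 1))"
begin

lemma partial_component:
  assumes "x \<in> U"
  shows "partial l (component (g_tilde f1 f2) i j) x =
    (if i = 1 \<and> j = 1 \<and> l = 2 then - 2 * h1' (x $ 2) / h1 (x $ 2) ^ 3
     else if i = 2 \<and> j = 2 \<and> l = 1 then - 2 * h2' (x $ 1) / h2 (x $ 1) ^ 3
     else 0)"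
proof -
  have 1: "((\<lambda>t. 1 / h1 t ^ 2) has_real_derivative - 2 * h1' (x $ 2) / h1 (x $ 2) ^ 3) (at (x $ 2))"
    using nz1[OF assms] by (auto intro!: derivative_eq_intros D1[OF assms]
      simp: field_simps eval_nat_numeral)
  have 2: "((\<lambda>t. 1 / h2 t ^ 2) has_real_derivative - 2 * h2' (x $ 1) / h2 (x $ 1) ^ 3) (at (x $ 1))"
    using nz2[OF assms] by (auto intro!: derivative_eq_intros D2[OF assms]
      simp: field_simps eval_nat_numeral)
  have p1: "partial l (\<lambda>x. 1 / (f1 x)^2) x = (if l = 2 then - 2 * h1' (x $ 2) / h1 (x $ 2) ^ 3 else 0)"
    using partial_separated[OF open_U assms _ DERIV_const[of 1] 1, of "\<lambda>x. 1 / (f1 x)^2" l] f1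
    by auto
  have p2: "partial l (\<lambda>x. 1 / (f2 x)^2) x = (if l = 1 then - 2 * h2' (x $ 1) / h2 (x $ 1) ^ 3 else 0)"
    using partial_separated[OF open_U assms _ 2 DERIV_const[of 1], of "\<lambda>x. 1 / (f2 x)^2" l] f2
    by auto
  show ?thesis
    using p1 p2 by (auto simp: component_g_tilde)
qed

text \<open>All 27 index triples are evaluated from the diagonal metric. Mixed terms are kept as a
  factor in \<open>x $ 1\<close> times a factor in \<open>x $ 2\<close>, the shape that
  \<open>partial_separated\<close> expects.\<close>

lemma christoffel_eq:
  assumes "x \<in> U"
  shows "christoffel (g_tilde f1 f2) k i j x =
    (if k = 1 \<and> (i = 1 \<and> j = 2 \<or> i = 2 \<and> j = 1) then - h1' (x $ 2) / h1 (x $ 2)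
     else if k = 2 \<and> (i = 1 \<and> j = 2 \<or> i = 2 \<and> j = 1) then - h2' (x $ 1) / h2 (x $ 1)
     else if k = 1 \<and> i = 2 \<and> j = 2 then (h2' (x $ 1) / h2 (x $ 1) ^ 3) * h1 (x $ 2) ^ 2
     else if k = 2 \<and> i = 1 \<and> j = 1 then h2 (x $ 1) ^ 2 * (h1' (x $ 2) / h1 (x $ 2) ^ 3)
     else 0)"
  using exhaust_3[of k] exhaust_3[of i] exhaust_3[of j] nz1[OF assms] nz2[OF assms]
  by (elim disjE; simp add: christoffel_def sum_3 partial_component[OF assms] inverse_component_g_tilde
      f1[OF assms] f2[OF assms]; simp add: field_simps eval_nat_numeral)

lemma partial_christoffel:
  assumes "x \<in> U"
  shows "partial l (christoffel (g_tilde f1 f2) k i j) x =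
    (if k = 1 \<and> (i = 1 \<and> j = 2 \<or> i = 2 \<and> j = 1) then
       if l = 2 then (h1' (x $ 2) ^ 2 - h1'' (x $ 2) * h1 (x $ 2)) / h1 (x $ 2) ^ 2 else 0
     else if k = 2 \<and> (i = 1 \<and> j = 2 \<or> i = 2 \<and> j = 1) then
       if l = 1 then (h2' (x $ 1) ^ 2 - h2'' (x $ 1) * h2 (x $ 1)) / h2 (x $ 1) ^ 2 else 0
     else if k = 1 \<and> i = 2 \<and> j = 2 then
       if l = 1 then (h2'' (x $ 1) * h2 (x $ 1) - 3 * h2' (x $ 1) ^ 2) / h2 (x $ 1) ^ 4 * h1 (x $ 2) ^ 2
       else if l = 2 then (h2' (x $ 1) / h2 (x $ 1) ^ 3) * (2 * h1 (x $ 2) * h1' (x $ 2)) else 0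
     else if k = 2 \<and> i = 1 \<and> j = 1 then
       if l = 1 then (2 * h2 (x $ 1) * h2' (x $ 1)) * (h1' (x $ 2) / h1 (x $ 2) ^ 3)
       else if l = 2 then h2 (x $ 1) ^ 2 * ((h1'' (x $ 2) * h1 (x $ 2) - 3 * h1' (x $ 2) ^ 2) / h1 (x $ 2) ^ 4) else 0
     else 0)"
proof -
  note nz = nz1[OF assms] nz2[OF assms]
  note D = D1[OF assms] DD1[OF assms] D2[OF assms] DD2[OF assms]
  \<comment> \<open>The six facts \<open>q1\<close> to \<open>s2\<close> differentiate the
    one-variable factors from which the nonzero Christoffel symbols are built.\<close>
  have q1: "((\<lambda>t. - h1' t / h1 t) has_real_derivative
      (h1' (x $ 2) ^ 2 - h1'' (x $ 2) * h1 (x $ 2)) / h1 (x $ 2) ^ 2) (at (x $ 2))"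
    using nz by (auto intro!: derivative_eq_intros D simp: field_simps eval_nat_numeral)
  have q2: "((\<lambda>t. - h2' t / h2 t) has_real_derivative
      (h2' (x $ 1) ^ 2 - h2'' (x $ 1) * h2 (x $ 1)) / h2 (x $ 1) ^ 2) (at (x $ 1))"
    using nz by (auto intro!: derivative_eq_intros D simp: field_simps eval_nat_numeral)
  have c1: "((\<lambda>t. h1' t / h1 t ^ 3) has_real_derivative
      (h1'' (x $ 2) * h1 (x $ 2) - 3 * h1' (x $ 2) ^ 2) / h1 (x $ 2) ^ 4) (at (x $ 2))"
    using nz by (auto intro!: derivative_eq_intros D simp: field_simps eval_nat_numeral)
  have c2: "((\<lambda>t. h2' t / h2 t ^ 3) has_real_derivative
      (h2'' (x $ 1) * h2 (x $ 1) - 3 * h2' (x $ 1) ^ 2) / h2 (x $ 1) ^ 4) (at (x $ 1))"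
    using nz by (auto intro!: derivative_eq_intros D simp: field_simps eval_nat_numeral)
  have s1: "((\<lambda>t. h1 t ^ 2) has_real_derivative 2 * h1 (x $ 2) * h1' (x $ 2)) (at (x $ 2))"
    by (auto intro!: derivative_eq_intros D)
  have s2: "((\<lambda>t. h2 t ^ 2) has_real_derivative 2 * h2 (x $ 1) * h2' (x $ 1)) (at (x $ 1))"
    by (auto intro!: derivative_eq_intros D)
  note P = partial_separated[OF open_U assms, of "christoffel (g_tilde f1 f2) k i j"]
  consider (a) "k = 1 \<and> (i = 1 \<and> j = 2 \<or> i = 2 \<and> j = 1)"
    | (b) "k = 2 \<and> (i = 1 \<and> j = 2 \<or> i = 2 \<and> j = 1)"
    | (c) "k = 1 \<and> i = 2 \<and> j = 2"
    | (d) "k = 2 \<and> i = 1 \<and> j = 1"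
    | (e) "\<not> (k = 1 \<and> (i = 1 \<and> j = 2 \<or> i = 2 \<and> j = 1))"
      "\<not> (k = 2 \<and> (i = 1 \<and> j = 2 \<or> i = 2 \<and> j = 1))"
      "\<not> (k = 1 \<and> i = 2 \<and> j = 2)" "\<not> (k = 2 \<and> i = 1 \<and> j = 1)"
    by blast
  then show ?thesis
  proof cases
    case a
    then show ?thesis using P[OF _ DERIV_const[of 1] q1, of l] by (auto simp: christoffel_eq)
  next
    case b
    then show ?thesis using P[OF _ q2 DERIV_const[of 1], of l] by (auto simp: christoffel_eq)
  next
    case c
    then show ?thesis using P[OF _ c2 s1, of l] by (auto simp: christoffel_eq)
  next
    case d
    then show ?thesis using P[OF _ s2 c1, of l] by (auto simp: christoffel_eq)
  next
    case e
    \<comment> \<open>Differentiation needs the symbol to vanish throughout \<open>U\<close>, not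
      only at \<open>x\<close>. Zero is then read as a product of two zero constants.\<close>
    then have "christoffel (g_tilde f1 f2) k i j z = 0" if "z \<in> U" for z
      using that by (simp only: christoffel_eq if_False)
    then have "partial l (christoffel (g_tilde f1 f2) k i j) x = 0"
      using P[OF _ DERIV_const[of 0] DERIV_const[of 0], of l] by simp
    with e show ?thesis by (simp only: if_False)
  qed
qed

text \<open>Only the plane of the first two coordinates is curved, and \<open>E\<close> is its
  sectional curvature divided by \<open>h1 (x $ 2) ^ 2 * h2 (x $ 1) ^ 2\<close>. The proof evaluates
  all 81 index combinations.\<close>

lemma riemann_tensor_eq:
  assumes "x \<in> U"
  defines "E \<equiv> (h1'' (x $ 2) * h1 (x $ 2) - 2 * h1' (x $ 2) ^ 2) / h1 (x $ 2) ^ 4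
             + (h2'' (x $ 1) * h2 (x $ 1) - 2 * h2' (x $ 1) ^ 2) / h2 (x $ 1) ^ 4"
  shows "riemann_tensor (g_tilde f1 f2) l k i j x =
    (if l = 1 \<and> k = 2 \<and> i = 1 \<and> j = 2 then h1 (x $ 2) ^ 2 * E
     else if l = 1 \<and> k = 2 \<and> i = 2 \<and> j = 1 then - (h1 (x $ 2) ^ 2 * E)
     else if l = 2 \<and> k = 1 \<and> i = 1 \<and> j = 2 then - (h2 (x $ 1) ^ 2 * E)
     else if l = 2 \<and> k = 1 \<and> i = 2 \<and> j = 1 then h2 (x $ 1) ^ 2 * E
     else 0)"
  using exhaust_3[of l] exhaust_3[of k] exhaust_3[of i] exhaust_3[of j] nz1[OF assms(1)] nz2[OF assms(1)]
  unfolding E_def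
  by (elim disjE; simp add: riemann_tensor_def sum_3 partial_christoffel[OF assms(1)]
      christoffel_eq[OF assms(1)]; simp add: field_simps eval_nat_numeral)

end

section \<open>Flatness as a separated equation, and separation of variables\<close>

theorem proposition2p8:
  fixes I1 I2 I3 :: "real set"
    and f1 f2 :: "real^3 \<Rightarrow> real"
    and h1 h2 :: "real \<Rightarrow> real"
  assumes "open I1" "is_interval I1"
    and "open I2" "is_interval I2"
    and "open I3" "is_interval I3"
    and "smooth_on (box3 I1 I2 I3) f1" "\<forall>x\<in>box3 I1 I2 I3. f1 x \<noteq> 0"
    and "smooth_on (box3 I1 I2 I3) f2" "\<forall>x\<in>box3 I1 I2 I3. f2 x \<noteq> 0"
    and "\<forall>x\<in>box3 I1 I2 I3. f1 x = h1 (x $ 2)"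
    and "\<forall>x\<in>box3 I1 I2 I3. f2 x = h2 (x $ 1)"
  shows "flat_riemannian_on (box3 I1 I2 I3) (g_tilde f1 f2) \<longleftrightarrow>
    (\<exists>c. \<forall>x\<in>box3 I1 I2 I3.
       (deriv (deriv h1) (x $ 2) * h1 (x $ 2) - 2 * (deriv h1 (x $ 2))^2) / (h1 (x $ 2))^4 = c \<and>
       - ((deriv (deriv h2) (x $ 1) * h2 (x $ 1) - 2 * (deriv h2 (x $ 1))^2) / (h2 (x $ 1))^4) = c)"
proof -
  let ?U = "box3 I1 I2 I3"
  let ?E1 = "\<lambda>t. (deriv (deriv h1) t * h1 t - 2 * (deriv h1 t)^2) / (h1 t)^4"
  let ?E2 = "\<lambda>t. (deriv (deriv h2) t * h2 t - 2 * (deriv h2 t)^2) / (h2 t)^4"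
  have U: "open ?U" using assms by (intro open_box3)
  interpret separated_metric ?U f1 f2 h1 "deriv h1" "deriv (deriv h1)" h2 "deriv h2" "deriv (deriv h2)"
  proof
    fix x assume x: "x \<in> ?U"
    show "h1 (x $ 2) \<noteq> 0" "h2 (x $ 1) \<noteq> 0" using assms x by metis+
    show "(h1 has_real_derivative deriv h1 (x $ 2)) (at (x $ 2))"
      "(deriv h1 has_real_derivative deriv (deriv h1) (x $ 2)) (at (x $ 2))"
      using single_coordinate_twice_derivative[OF U assms(7) _ x] assms(11) by blast+
    show "(h2 has_real_derivative deriv h2 (x $ 1)) (at (x $ 1))"
      "(deriv h2 has_real_derivative deriv (deriv h2) (x $ 1)) (at (x $ 1))"
      using single_coordinate_twice_derivative[OF U assms(9) _ x] assms(12) by blast+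
  qed (use U assms in auto)
  have "riemannian_metric_on ?U (g_tilde f1 f2)"
    using U assms by (intro riemannian_metric_g_tilde) auto
  moreover have "(\<forall>l k i j. riemann_tensor (g_tilde f1 f2) l k i j x = 0) \<longleftrightarrow>
      ?E1 (x $ 2) = - ?E2 (x $ 1)" if "x \<in> ?U" for x
  proof
    assume "\<forall>l k i j. riemann_tensor (g_tilde f1 f2) l k i j x = 0"
    \<comment> \<open>This component is \<open>h1 (x $ 2) ^ 2\<close> times the sum of the two
      expressions, and the factor \<open>h1 (x $ 2)\<close> is nonzero.\<close>
    then have "riemann_tensor (g_tilde f1 f2) 1 2 1 2 x = 0" by blast
    then have "?E1 (x $ 2) + ?E2 (x $ 1) = 0"
      using nz1[OF that] by (simp only: riemann_tensor_eq[OF that]) simp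
    then show "?E1 (x $ 2) = - ?E2 (x $ 1)" by linarith
  next
    assume "?E1 (x $ 2) = - ?E2 (x $ 1)"
    then have "?E1 (x $ 2) + ?E2 (x $ 1) = 0" by linarith
    then show "\<forall>l k i j. riemann_tensor (g_tilde f1 f2) l k i j x = 0"
      by (simp only: riemann_tensor_eq[OF that]) simp
  qed
  ultimately have "flat_riemannian_on ?U (g_tilde f1 f2) \<longleftrightarrow> (\<forall>x\<in>?U. ?E1 (x $ 2) = - ?E2 (x $ 1))"
    unfolding flat_riemannian_on_def by blast
  also have "\<dots> \<longleftrightarrow> (\<exists>c. \<forall>x\<in>?U. ?E1 (x $ 2) = c \<and> - ?E2 (x $ 1) = c)"
  proof
    assume sep: "\<forall>x\<in>?U. ?E1 (x $ 2) = - ?E2 (x $ 1)"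
    show "\<exists>c. \<forall>x\<in>?U. ?E1 (x $ 2) = c \<and> - ?E2 (x $ 1) = c"
    \<comment> \<open>In an empty box any constant works; otherwise the constant is the value of
      \<open>?E1\<close> at a base point \<open>p\<close>.\<close>
    proof (cases "?U = {}")
      case False
      then obtain p where p: "p \<in> ?U" by blast
      have "?E1 (x $ 2) = ?E1 (p $ 2)" if "x \<in> ?U" for x
      proof -
        \<comment> \<open>The product shape of the box allows mixing coordinates. This point shares
          \<open>x $ 2\<close> with \<open>x\<close> and \<open>p $ 1\<close> with \<open>p\<close>,
          so \<open>sep\<close> here and at \<open>p\<close> has the same right-hand side.\<close>
        have "vector [p $ 1, x $ 2, p $ 3] \<in> ?U"
          using p that by (simp add: box3_def)
        from bspec[OF sep this] bspec[OF sep p] show ?thesis by simp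
      qed
      then have "\<forall>x\<in>?U. ?E1 (x $ 2) = ?E1 (p $ 2) \<and> - ?E2 (x $ 1) = ?E1 (p $ 2)"
        using sep by metis
      then show ?thesis by blast
    qed simp
  next
    assume "\<exists>c. \<forall>x\<in>?U. ?E1 (x $ 2) = c \<and> - ?E2 (x $ 1) = c"
    then show "\<forall>x\<in>?U. ?E1 (x $ 2) = - ?E2 (x $ 1)" by metis
  qed
  finally show ?thesis .
qed

end
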